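(* The discrete Schwarz–Pick lemma fails for inversive distances $I\ge 1$ in Euclidean background geometry. Precisely: (1) Let $(\mathbb D,\mathcal T,I)$ be the weighted triangulated disk with Euclidean background geometry having vertices $V=\{1,2,3,4\}$, edges all six pairs of vertices, faces $F=\{\{1,2,4\},\{1,3,4\},\{2,3,4\}\}$, interior vertex set $A=\{4\}$, boundary vertex set $B=\{1,2,3\}$, and inversive distances $I_{24}=4$, $I_{34}=3$, and $I_e=1$ for every other edge $e$. Then $r=(r_1,r_2,r_3,r_4)=(100,100,100,155)$ and $R=(R_1,R_2,R_3,R_4)=(110,240,220,150)$ are circle packing metrics for $(\mathbb D,\mathcal T,I)$ satisfying $R(i)\ge r(i)$ for all $i\in B$ and $K_R(4)\ge K_r(4)$, but $R(4)<r(4)$. (2) Consequently, there exist a closed connected weighted triangulated surface $(S',\mathcal T',I')$ with Euclidean background geometry and $I'\ge 1$ on every edge, a partition $V'=A'\sqcup B'$ of its vertex set with $A'\ne\varnothing$ and $B'\neq\varnothing$, and circle packing metrics $R',r'$ for $(S',\mathcal T',I')$ with $R'(i)\ge r'(i)$ for all $i\in B'$ and $K_{R'}(i)\ge K_{r'}(i)$ for all $i\in A'$, but with $R'(i)<r'(i)$ for some $i\in A'$.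
   Context: Weighted triangulated surface: $S$ is a surface (possibly with boundary) with a finite simplicial triangulation $\mathcal T=(V,E,F)$ (vertices, edges, faces), and $I:E\to(-1,\infty)$, $I_{ij}=I(ij)$, assigns an inversive distance to each edge. "Closed" means compact without boundary. A radius function is a map $r:V\to(0,\infty)$, $r_i=r(i)$. In Euclidean background geometry it induces edge lengths $$l_r(ij)=\sqrt{r_i^2+r_j^2+2r_ir_jI_{ij}} .$$ The radius function $r$ is called a circle packing metric for $(S,\mathcal T,I)$ if for every face $ijk\in F$ the three lengths $l_r(ij),l_r(jk),l_r(ik)$ satisfy the strict triangle inequalities. In that case each face is realized as a Euclidean triangle with these side lengths, and the discrete curvature at $i\in V$ is $K_r(i)=2\pi-\sum_{\tau\in F,\ i\in\tau}\theta_i^\tau$, where $\theta_i^\tau$ is the inner angle at vertex $i$ of the triangle $\tau$ (for the disk only the curvature at the interior vertex is used). *)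

theory Defs
  imports "HOL-Analysis.Analysis"
begin

section \<open>Triangulated surfaces\<close>

definition plane_point :: "'a topology \<Rightarrow> 'a \<Rightarrow> bool" where
  "plane_point X x \<longleftrightarrow> (\<exists>U (W :: (real^2) set). openin X U \<and> x \<in> U \<and> open W \<and>
     subtopology X U homeomorphic_space top_of_set W)"

definition half_plane_point :: "'a topology \<Rightarrow> 'a \<Rightarrow> bool" where
  "half_plane_point X x \<longleftrightarrow> (\<exists>U (W :: (real^2) set). openin X U \<and> x \<in> U \<and>
     openin (top_of_set {z. 0 \<le> z $ 2}) W \<and> subtopology X U homeomorphic_space top_of_set W)"

text \<open>Topological 2-manifolds, possibly with boundary. The open subsets of the open upper half
  plane are among the chart domains in \<^const>\<open>half_plane_point\<close>.\<close>

definition surface :: "'a topology \<Rightarrow> bool" where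
  "surface X \<longleftrightarrow> Hausdorff_space X \<and> second_countable X \<and> (\<forall>x\<in>topspace X. half_plane_point X x)"

definition surface_boundary :: "'a topology \<Rightarrow> 'a set" where
  "surface_boundary X = {x \<in> topspace X. \<not> plane_point X x}"

definition closed_surface :: "'a topology \<Rightarrow> bool" where
  "closed_surface X \<longleftrightarrow> surface X \<and> compact_space X \<and> surface_boundary X = {}"

record 'v complex2 =
  verts :: "'v set"
  edges :: "'v set set"
  faces :: "'v set set"

definition simplicial_complex2 :: "'v complex2 \<Rightarrow> bool" where
  "simplicial_complex2 T \<longleftrightarrow> finite (verts T) \<and>
     (\<forall>e\<in>edges T. e \<subseteq> verts T \<and> card e = 2) \<and>
     (\<forall>f\<in>faces T. f \<subseteq> verts T \<and> card f = 3) \<and>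
     (\<forall>f\<in>faces T. \<forall>e. e \<subseteq> f \<and> card e = 2 \<longrightarrow> e \<in> edges T)"

definition simplices :: "'v complex2 \<Rightarrow> 'v set set" where
  "simplices T = (\<lambda>v. {v}) ` verts T \<union> edges T \<union> faces T"

text \<open>Geometric realization in barycentric coordinates. Only the finitely many coordinates in
  \<^term>\<open>verts T\<close> can be nonzero, so the product topology on functions is the usual one here.\<close>

definition realization :: "'v complex2 \<Rightarrow> ('v \<Rightarrow> real) topology" where
  "realization T = top_of_set {x. (\<forall>v. 0 \<le> x v) \<and> {v. x v \<noteq> 0} \<in> simplices T \<and>
     (\<Sum>v\<in>verts T. x v) = 1}"

definition vertex_point :: "'v \<Rightarrow> 'v \<Rightarrow> real" where
  "vertex_point v = (\<lambda>w. if w = v then 1 else 0)"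

definition triangulated_surface :: "'a topology \<Rightarrow> 'v complex2 \<Rightarrow> bool" where
  "triangulated_surface S T \<longleftrightarrow>
     surface S \<and> simplicial_complex2 T \<and> S homeomorphic_space realization T"

definition boundary_vertices :: "'v complex2 \<Rightarrow> 'v set" where
  "boundary_vertices T = {v \<in> verts T. vertex_point v \<in> surface_boundary (realization T)}"

definition interior_vertices :: "'v complex2 \<Rightarrow> 'v set" where
  "interior_vertices T = verts T - boundary_vertices T"

definition weighted_triangulated_surface ::
    "'a topology \<Rightarrow> 'v complex2 \<Rightarrow> ('v set \<Rightarrow> real) \<Rightarrow> bool" where
  "weighted_triangulated_surface S T I \<longleftrightarrow> triangulated_surface S T \<and> (\<forall>e\<in>edges T. - 1 < I e)"

section \<open>Euclidean inversive distance circle packings\<close>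

definition edge_length :: "('v set \<Rightarrow> real) \<Rightarrow> ('v \<Rightarrow> real) \<Rightarrow> 'v \<Rightarrow> 'v \<Rightarrow> real" where
  "edge_length I r i j = sqrt ((r i)\<^sup>2 + (r j)\<^sup>2 + 2 * r i * r j * I {i, j})"

text \<open>The quantification over all \<open>i\<close>, \<open>j\<close>, \<open>k\<close> gives all three triangle inequalities of a face.\<close>

definition circle_packing_metric ::
    "'v complex2 \<Rightarrow> ('v set \<Rightarrow> real) \<Rightarrow> ('v \<Rightarrow> real) \<Rightarrow> bool" where
  "circle_packing_metric T I r \<longleftrightarrow> (\<forall>i\<in>verts T. 0 < r i) \<and>
     (\<forall>i j k. {i, j, k} \<in> faces T \<longrightarrow>
        edge_length I r i j < edge_length I r i k + edge_length I r j k)"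

definition vector_angle :: "real^2 \<Rightarrow> real^2 \<Rightarrow> real" where
  "vector_angle u v = arccos (u \<bullet> v / (norm u * norm v))"

definition realizes_face ::
    "('v set \<Rightarrow> real) \<Rightarrow> ('v \<Rightarrow> real) \<Rightarrow> 'v set \<Rightarrow> ('v \<Rightarrow> real^2) \<Rightarrow> bool" where
  "realizes_face I r t P \<longleftrightarrow>
     (\<forall>i\<in>t. \<forall>j\<in>t. i \<noteq> j \<longrightarrow> dist (P i) (P j) = edge_length I r i j)"

definition inner_angle :: "('v set \<Rightarrow> real) \<Rightarrow> ('v \<Rightarrow> real) \<Rightarrow> 'v set \<Rightarrow> 'v \<Rightarrow> real" where
  "inner_angle I r t i = (THE a. \<exists>P j k. realizes_face I r t P \<and> t = {i, j, k} \<and>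
     distinct [i, j, k] \<and> a = vector_angle (P j - P i) (P k - P i))"

definition curvature ::
    "'v complex2 \<Rightarrow> ('v set \<Rightarrow> real) \<Rightarrow> ('v \<Rightarrow> real) \<Rightarrow> 'v \<Rightarrow> real" where
  "curvature T I r i = 2 * pi - (\<Sum>t | t \<in> faces T \<and> i \<in> t. inner_angle I r t i)"

text \<open>Well-definedness of \<^const>\<open>inner_angle\<close>: the triangle exists, and its angle depends only on
  the side lengths.\<close>

lemma edge_length_commute: "edge_length I r i j = edge_length I r j i"
  by (simp add: edge_length_def insert_commute algebra_simps)

lemma vector_angle_cosine_law:
  "vector_angle (q - p) (s - p) =
     arccos (((dist p q)\<^sup>2 + (dist p s)\<^sup>2 - (dist q s)\<^sup>2) / (2 * dist p q * dist p s))"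
proof -
  have "(dist p q)\<^sup>2 + (dist p s)\<^sup>2 - (dist q s)\<^sup>2 = 2 * ((q - p) \<bullet> (s - p))"
    by (simp add: dist_norm power2_norm_eq_inner inner_diff_left inner_diff_right inner_commute)
  then show ?thesis
    by (simp add: vector_angle_def dist_norm norm_minus_commute)
qed

lemma euclidean_triangle_exists:
  fixes a b c :: real
  assumes "a < b + c" "b < a + c" "c < a + b"
  obtains p q s :: "real^2" where "dist p q = a" "dist p s = b" "dist q s = c"
proof -
  have pos: "a > 0" "b > 0" "c > 0" using assms by auto
  define x where "x = (a\<^sup>2 + b\<^sup>2 - c\<^sup>2) / (2 * a)"
  have ax: "2 * a * x = a\<^sup>2 + b\<^sup>2 - c\<^sup>2" using pos by (simp add: x_def)
  have "(2 * a * b)\<^sup>2 - (2 * a * x)\<^sup>2 = (a + b + c) * (a + b - c) * (c + a - b) * (c + b - a)"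
    unfolding ax by (simp add: power2_eq_square algebra_simps)
  also have "\<dots> > 0" using assms pos by (intro mult_pos_pos) auto
  finally have "(2 * a)\<^sup>2 * (b\<^sup>2 - x\<^sup>2) > 0" by (simp add: power_mult_distrib algebra_simps)
  then have bx: "b\<^sup>2 - x\<^sup>2 > 0" by (simp add: zero_less_mult_iff)
  define y where "y = sqrt (b\<^sup>2 - x\<^sup>2)"
  have y2: "y\<^sup>2 = b\<^sup>2 - x\<^sup>2" using bx by (simp add: y_def)
  let ?p = "0 :: real^2" and ?q = "vector [a, 0] :: real^2" and ?s = "vector [x, y] :: real^2"
  have "dist ?p ?q = a" "dist ?p ?s = b" "dist ?q ?s = c"
  proof -
    show "dist ?p ?q = a"
      using pos by (simp add: dist_norm norm_eq_sqrt_inner inner_vec_def sum_2)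
    show "dist ?p ?s = b"
      using pos y2 by (simp add: dist_norm norm_eq_sqrt_inner inner_vec_def sum_2 flip: power2_eq_square)
    have "(a - x)\<^sup>2 + y\<^sup>2 = c\<^sup>2" using ax y2 by (simp add: power2_eq_square algebra_simps)
    then show "dist ?q ?s = c"
      using pos by (simp add: dist_norm norm_eq_sqrt_inner inner_vec_def sum_2 flip: power2_eq_square)
  qed
  then show thesis by (rule that)
qed

lemma inner_angle_cosine_law:
  assumes d: "distinct [i, j, k]"
    and "edge_length I r i j < edge_length I r i k + edge_length I r j k"
    and "edge_length I r i k < edge_length I r i j + edge_length I r j k"
    and "edge_length I r j k < edge_length I r i j + edge_length I r i k"
  shows "inner_angle I r {i, j, k} i =
    arccos (((edge_length I r i j)\<^sup>2 + (edge_length I r i k)\<^sup>2 - (edge_length I r j k)\<^sup>2) /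
      (2 * edge_length I r i j * edge_length I r i k))" (is "_ = ?a")
proof -
  obtain p q s :: "real^2" where pqs: "dist p q = edge_length I r i j"
    "dist p s = edge_length I r i k" "dist q s = edge_length I r j k"
    using euclidean_triangle_exists assms(2-4) by metis
  define P where "P = (\<lambda>v. if v = i then p else if v = j then q else s)"
  have P: "realizes_face I r {i, j, k} P"
    using d pqs by (auto simp: realizes_face_def P_def dist_commute edge_length_commute)
  have Pa: "vector_angle (P j - P i) (P k - P i) = ?a"
  proof -
    have "P i = p" "P j = q" "P k = s" using d by (auto simp: P_def)
    then show ?thesis using pqs by (simp add: vector_angle_cosine_law)
  qed
  have "a = ?a" if Q: "realizes_face I r {i, j, k} Q" and e: "{i, j, k} = {i, m, n}"
    "distinct [i, m, n]" and a: "a = vector_angle (Q m - Q i) (Q n - Q i)" for a Q m n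
  proof -
    have "m = j \<and> n = k \<or> m = k \<and> n = j" using d e by (auto simp: doubleton_eq_iff)
    then show ?thesis
    proof
      assume mn: "m = j \<and> n = k"
      have "dist (Q i) (Q j) = edge_length I r i j" "dist (Q i) (Q k) = edge_length I r i k"
        "dist (Q j) (Q k) = edge_length I r j k"
        using Q d by (simp_all add: realizes_face_def)
      then show ?thesis using mn by (simp add: a vector_angle_cosine_law)
    next
      assume mn: "m = k \<and> n = j"
      have "dist (Q i) (Q j) = edge_length I r i j" "dist (Q i) (Q k) = edge_length I r i k"
        "dist (Q k) (Q j) = edge_length I r j k"
        using Q d edge_length_commute[of I r j k] by (auto simp: realizes_face_def)
      then show ?thesis using mn by (simp add: a vector_angle_cosine_law ac_simps)
    qed
  qed
  note uniq = this
  show ?thesis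
    unfolding inner_angle_def
  proof (rule the_equality)
    show "\<exists>P' j' k'. realizes_face I r {i, j, k} P' \<and> {i, j, k} = {i, j', k'} \<and>
        distinct [i, j', k'] \<and> ?a = vector_angle (P' j' - P' i) (P' k' - P' i)"
      by (intro exI[of _ P] exI[of _ j] exI[of _ k] conjI P d Pa[symmetric] refl)
  qed (use uniq in \<open>elim exE conjE\<close>)
qed

end

(* All angles at vertex 4 are computed by the cosine law. In the metric r they are at least 0.442, 0.577
   and 0.524, in the metric R at most 0.124, 0.570 and 0.832, so the angle sum is smaller for R.
   Adding the face {1,2,3} to the disk gives the boundary of a tetrahedron, a sphere in which vertex 4
   keeps its three faces; as all inversive distances on the new face are 1, its edge lengths are sums
   of radii and satisfy the triangle inequalities. So the same data also refute the closed case. *)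

theory Submission
  imports Defs
begin

text \<open>If all circles were tangent, enlarging circles 1, 2, 3 and shrinking circle 4 could only
  enlarge the angles at 4. A large inversive distance breaks this: in the face {1,2,4}, with
  inversive distance 4 on one side, the angle drops to less than a third, and this outweighs the
  gain in {2,3,4}. The rounded bounds add up to 1.543 for r and 1.526 for R, a margin of 0.017. Most
  of the work is topological. Surfaces and their boundaries are defined by charts, so that 1, 2, 3
  are boundary vertices asserts the nonexistence of planar charts, which rests on invariance of
  domain. One piecewise linear chart, that of the closed star of a vertex, serves both surfaces: the
  disk is the closed star of 4, and the sphere is covered by four open stars.\<close>

section \<open>Charts on subspaces\<close>

text \<open>Bridge from the abstract topologies of the definitions to sets, for which invariance of
  domain and the results on convex bodies are stated.\<close>

lemma top_of_set_homeomorphic_space: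
  "top_of_set S homeomorphic_space top_of_set T \<longleftrightarrow> S homeomorphic T"
proof -
  have "homeomorphic_maps (top_of_set S) (top_of_set T) f g \<longleftrightarrow> homeomorphism S T f g" for f g
  proof
    assume "homeomorphic_maps (top_of_set S) (top_of_set T) f g"
    then show "homeomorphism S T f g"
      by (intro homeomorphismI) (auto simp: homeomorphic_maps_def continuous_map_in_subtopology)
  next
    assume "homeomorphism S T f g"
    then show "homeomorphic_maps (top_of_set S) (top_of_set T) f g"
      by (auto simp: homeomorphic_maps_def homeomorphism_def)
  qed
  then show ?thesis by (simp add: homeomorphic_space_def homeomorphic_def)
qed

lemma plane_point_top_of_set:
  "plane_point (top_of_set S) x \<longleftrightarrow>
     (\<exists>U (W :: (real^2) set). openin (top_of_set S) U \<and> x \<in> U \<and> open W \<and> U homeomorphic W)"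
proof -
  have "subtopology (top_of_set S) U = top_of_set U" if "openin (top_of_set S) U" for U
    using openin_imp_subset[OF that] by (simp add: subtopology_subtopology Int_absorb1)
  then show ?thesis
    unfolding plane_point_def by (metis top_of_set_homeomorphic_space)
qed

text \<open>The coordinatewise exponential embeds the plane into the open first quadrant, hence into
  the half plane; by invariance of domain the image of a chart domain is open.\<close>

lemma plane_point_imp_half_plane_point:
  assumes "plane_point X x"
  shows "half_plane_point X x"
proof -
  obtain U and W :: "(real^2) set" where U: "openin X U" "x \<in> U" "open W"
    "subtopology X U homeomorphic_space top_of_set W"
    using assms by (auto simp: plane_point_def)
  define h :: "real^2 \<Rightarrow> real^2" where "h z = (\<chi> i. exp (z $ i))" for z
  have cont: "continuous_on W h" unfolding h_def by (intro continuous_intros)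
  have inj: "inj_on h W" by (auto simp: inj_on_def h_def vec_eq_iff)
  have "open (h ` W)" using invariance_of_domain[OF cont U(3) inj] .
  moreover have "h ` W \<subseteq> {z. 0 \<le> z $ 2}" by (auto simp: h_def)
  ultimately have "openin (top_of_set {z. 0 \<le> z $ 2}) (h ` W)" by (rule open_subset[rotated])
  moreover have "W homeomorphic h ` W"
    by (rule invariance_of_domain_homeomorphic[OF U(3) cont _ inj]) simp
  then have "subtopology X U homeomorphic_space top_of_set (h ` W)"
    using U(4) homeomorphic_space_trans top_of_set_homeomorphic_space by blast
  ultimately show ?thesis using U by (auto simp: half_plane_point_def)
qed

text \<open>A planar chart at \<open>x\<close>, carried over by \<open>f\<close>, has open image in
  the plane by invariance of domain, so this image lies in the interior of \<open>K\<close>. The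
  direction from left to right is what detects boundary points.\<close>

lemma plane_point_iff_interior:
  fixes K :: "(real^2) set"
  assumes "homeomorphism S K f g" "x \<in> S"
  shows "plane_point (top_of_set S) x \<longleftrightarrow> f x \<in> interior K"
proof
  assume "plane_point (top_of_set S) x"
  then have "\<exists>U (W :: (real^2) set). openin (top_of_set S) U \<and> x \<in> U \<and> open W \<and> U homeomorphic W"
    by (rule iffD1[OF plane_point_top_of_set])
  then obtain U and W :: "(real^2) set" where U: "openin (top_of_set S) U" "x \<in> U" "open W"
    and UW: "U homeomorphic W"
    by (elim exE conjE) (rule that)
  have "W homeomorphic U" by (rule iffD1[OF homeomorphic_sym UW])
  then obtain p q where pq: "homeomorphism W U p q" by (auto simp: homeomorphic_def)
  have US: "U \<subseteq> S" using U(1) by (rule openin_imp_subset)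
  have "homeomorphism U (f ` U) f g" by (rule homeomorphism_of_subsets[OF assms(1) US]) auto
  from homeomorphism_compose[OF pq this]
  have fp: "homeomorphism W (f ` U) (f \<circ> p) (q \<circ> g)" .
  then have "open ((f \<circ> p) ` W)"
    using U(3) by (intro invariance_of_domain) (auto simp: homeomorphism_def intro: inj_on_inverseI)
  then have "open (f ` U)" using fp by (simp add: homeomorphism_def)
  moreover have "f ` U \<subseteq> K" using US assms(1) by (auto simp: homeomorphism_def)
  ultimately show "f x \<in> interior K" using U(2) by (auto intro: interiorI)
next
  assume x: "f x \<in> interior K"
  let ?U = "S \<inter> f -` interior K"
  have "openin (top_of_set S) ?U"
    using assms(1) by (intro continuous_openin_preimage_gen) (auto simp: homeomorphism_def)
  moreover have "f ` ?U = interior K"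
  proof
    show "interior K \<subseteq> f ` ?U"
    proof
      fix y assume y: "y \<in> interior K"
      then have "y \<in> K" using interior_subset by auto
      then have "f (g y) = y" "g y \<in> S" using assms(1) by (auto simp: homeomorphism_def)
      then show "y \<in> f ` ?U" using y by (metis IntI image_eqI vimageI)
    qed
  qed auto
  then have "homeomorphism ?U (interior K) f g"
    by (intro homeomorphism_of_subsets[OF assms(1)]) (auto simp: interior_subset)
  ultimately show "plane_point (top_of_set S) x"
    using x assms(2) unfolding plane_point_top_of_set homeomorphic_def
    by (intro exI[of _ ?U] exI[of _ "interior K"]) auto
qed

section \<open>Half-plane charts for the round disk\<close>

text \<open>Inversion in the unit circle about a boundary point \<open>q\<close> maps the unit disk minus \<open>q\<close> onto the
  half plane \<open>{w. w \<bullet> q \<le> - 1 / 2}\<close>; two such inversions supply charts for the whole disk.\<close>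

lemma cball_minus_point_homeomorphic_halfspace:
  fixes q :: "'a::euclidean_space"
  assumes q: "norm q = 1"
  shows "cball 0 1 - {q} homeomorphic {w. w \<bullet> q \<le> - 1 / 2}"
proof -
  define f g :: "'a \<Rightarrow> 'a" where "f z = (z - q) /\<^sub>R (norm (z - q))\<^sup>2"
    and "g w = q + w /\<^sub>R (norm w)\<^sup>2" for z w
  have qq: "q \<bullet> q = 1" using q by (simp add: norm_eq_1)
  have nz: "w \<noteq> 0" if "w \<bullet> q \<le> - 1 / 2" for w using that by auto
  have gf: "g (f z) = z" if "z \<noteq> q" for z
    using that by (simp add: f_def g_def inverse_eq_divide power2_eq_square)
  have fg: "f (g w) = w" if "w \<noteq> 0" for w
    using that by (simp add: f_def g_def inverse_eq_divide power2_eq_square)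
  \<comment> \<open>Expanding the square turns the ball condition into the sign of
    \<open>2 * (w \<bullet> q) + 1\<close>; this is the origin of the bound
    \<open>- 1 / 2\<close>.\<close>
  have ng: "(norm (g w))\<^sup>2 = 1 + (2 * (w \<bullet> q) + 1) / (norm w)\<^sup>2" if "w \<noteq> 0" for w
  proof -
    have ww: "w \<bullet> w > 0" using that by simp
    have "(norm (g w))\<^sup>2 = 1 + 2 * (w \<bullet> q) / (w \<bullet> w) + (w \<bullet> w) / (w \<bullet> w)\<^sup>2"
      unfolding g_def power2_norm_eq_inner
      by (simp add: inner_add_left inner_add_right qq inner_commute power2_eq_square field_simps)
    also have "\<dots> = 1 + (2 * (w \<bullet> q) + 1) / (w \<bullet> w)"
      using ww by (simp add: power2_eq_square field_simps)
    finally show ?thesis by (simp add: power2_norm_eq_inner)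
  qed
  have g1: "norm (g w) \<le> 1 \<longleftrightarrow> w \<bullet> q \<le> - 1 / 2" if "w \<noteq> 0" for w
  proof -
    have "norm (g w) \<le> 1 \<longleftrightarrow> (norm (g w))\<^sup>2 \<le> 1"
      using abs_le_square_iff[of "norm (g w)" 1] by simp
    also have "\<dots> \<longleftrightarrow> w \<bullet> q \<le> - 1 / 2" using that by (auto simp: ng divide_le_0_iff)
    finally show ?thesis .
  qed
  have fnz: "f z \<noteq> 0" if "z \<noteq> q" for z using that by (simp add: f_def)
  have gq: "g w \<noteq> q" if "w \<noteq> 0" for w using that by (simp add: g_def)
  have "homeomorphism (cball 0 1 - {q}) {w. w \<bullet> q \<le> - 1 / 2} f g"
  proof (rule homeomorphismI)
    show "continuous_on (cball 0 1 - {q}) f"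
      unfolding f_def by (intro continuous_intros) auto
    show "continuous_on {w. w \<bullet> q \<le> - 1 / 2} g"
      unfolding g_def by (intro continuous_intros) (use nz in auto)
    show "f ` (cball 0 1 - {q}) \<subseteq> {w. w \<bullet> q \<le> - 1 / 2}"
    proof (rule image_subsetI)
      fix z assume "z \<in> cball 0 1 - {q}"
      then have "z \<noteq> q" "norm z \<le> 1" by auto
      then show "f z \<in> {w. w \<bullet> q \<le> - 1 / 2}" using g1[of "f z"] gf fnz by auto
    qed
    show "g ` {w. w \<bullet> q \<le> - 1 / 2} \<subseteq> cball 0 1 - {q}"
      using g1 gq nz by auto
  qed (use gf fg nz in auto)
  then show ?thesis by (auto simp: homeomorphic_def)
qed

text \<open>For a pole \<open>q\<close> the inner product is the second coordinate up to the sign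
  \<open>s\<close>, so multiplication by \<open>- s\<close> and a shift by one half suffice.\<close>

lemma halfspace_homeomorphic_upper_half_plane:
  fixes q :: "real^2"
  assumes "q = axis 2 1 \<or> q = - axis 2 1"
  shows "{w. w \<bullet> q \<le> - 1 / 2} homeomorphic {z :: real^2. 0 \<le> z $ 2}"
proof -
  define s where "s = (if q = axis 2 1 then 1 else -1 :: real)"
  have s: "s * s = 1" and q: "q = s *\<^sub>R axis 2 1" using assms by (auto simp: s_def)
  have ss: "s * (s * a) = a" for a using s by (metis mult.assoc mult_1)
  have wq: "w \<bullet> q = s * w $ 2" for w by (simp add: q inner_axis)
  have "homeomorphism {w. w \<bullet> q \<le> - 1 / 2} {z :: real^2. 0 \<le> z $ 2}
     (\<lambda>w. - s *\<^sub>R w - axis 2 (1/2)) (\<lambda>z. - s *\<^sub>R (z + axis 2 (1/2)))"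
    by (rule homeomorphismI; (intro continuous_intros)?)
      (auto simp: wq s ss algebra_simps axis_def)
  then show ?thesis by (auto simp: homeomorphic_def)
qed

lemma second_countable_euclidean:
  "second_countable (euclidean :: 'a::second_countable_topology topology)"
proof -
  obtain B :: "'a set set" where B: "countable B" "\<And>C. C \<in> B \<Longrightarrow> open C"
    "\<And>S. open S \<Longrightarrow> \<exists>U. U \<subseteq> B \<and> S = \<Union>U"
    using univ_second_countable by metis
  have "\<exists>V\<in>B. x \<in> V \<and> V \<subseteq> U" if "open U" "x \<in> U" for U x
    using B(3)[OF that(1)] that(2) by blast
  with B(1,2) show ?thesis
    unfolding second_countable_def by (intro exI[of _ B]) simp
qed

lemma surface_cball: "surface (top_of_set (cball 0 1 :: (real^2) set))"
  unfolding surface_def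
proof (intro conjI ballI)
  show "Hausdorff_space (top_of_set (cball 0 1 :: (real^2) set))"
    by (simp add: Hausdorff_space_subtopology)
  show "second_countable (top_of_set (cball 0 1 :: (real^2) set))"
    by (intro second_countable_subtopology second_countable_euclidean)
  fix x :: "real^2" assume "x \<in> topspace (top_of_set (cball 0 1))"
  then have x: "x \<in> cball 0 1" by simp
  \<comment> \<open>Inversion fails only at its centre, so a pole different from \<open>x\<close> is
    chosen. Removing it leaves an open neighbourhood of \<open>x\<close>, also if \<open>x\<close>
    lies on the circle.\<close>
  define q :: "real^2" where "q = (if x = axis 2 1 then - axis 2 1 else axis 2 1)"
  have "axis 2 1 \<noteq> - (axis 2 1 :: real^2)" by (simp add: axis_def vec_eq_iff exI[of _ 2])
  then have q: "q = axis 2 1 \<or> q = - axis 2 1" "x \<noteq> q" by (auto simp: q_def)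
  then have "norm q = 1" by auto
  then have "cball 0 1 - {q} homeomorphic {z :: real^2. 0 \<le> z $ 2}"
    using cball_minus_point_homeomorphic_halfspace halfspace_homeomorphic_upper_half_plane[OF q(1)]
      homeomorphic_trans by blast
  then have "subtopology (top_of_set (cball 0 1)) (cball 0 1 - {q}) homeomorphic_space
      top_of_set {z :: real^2. 0 \<le> z $ 2}"
    by (simp add: subtopology_subtopology Int_absorb1 top_of_set_homeomorphic_space Diff_subset)
  moreover have "openin (top_of_set (cball 0 1)) (cball 0 1 - {q})"
    by (simp add: openin_delete)
  moreover have "x \<in> cball 0 1 - {q}" using x q(2) by blast
  moreover have "openin (top_of_set {z :: real^2. 0 \<le> z $ 2}) {z. 0 \<le> z $ 2}"
    by (rule openin_subtopology_self)
  ultimately show "half_plane_point (top_of_set (cball 0 1)) x"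
    unfolding half_plane_point_def by blast
qed

section \<open>The closed star of a vertex of a tetrahedron\<close>

text \<open>The triangle with corners (1,0), (0,1) and (-1,-1), the images of the vertices
  \<open>a\<close>, \<open>b\<close>, \<open>c\<close> under \<open>star_chart\<close>; the vertex
  \<open>d\<close> goes to the origin.\<close>

definition star_triangle :: "(real^2) set" where
  "star_triangle = {z. z $ 1 + z $ 2 \<le> 1 \<and> z $ 2 - 2 * z $ 1 \<le> 1 \<and> z $ 1 - 2 * z $ 2 \<le> 1}"

text \<open>The union of the three faces at the centre \<open>d\<close> in barycentric coordinates;
  the last clause leaves out the inside of the tetrahedron and of the face opposite to
  \<open>d\<close>.\<close>

definition vertex_star :: "'v \<Rightarrow> 'v \<Rightarrow> 'v \<Rightarrow> 'v \<Rightarrow> ('v \<Rightarrow> real) set" where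
  "vertex_star a b c d = {x. (\<forall>v. 0 \<le> x v) \<and> (\<forall>v. v \<notin> {a, b, c, d} \<longrightarrow> x v = 0) \<and>
     x a + x b + x c + x d = 1 \<and> (x a = 0 \<or> x b = 0 \<or> x c = 0)}"

text \<open>On the star the smallest of \<open>x a\<close>, \<open>x b\<close>, \<open>x c\<close> is zero, so the three of them are determined by
  the differences \<open>x a - x c\<close> and \<open>x b - x c\<close>.\<close>

definition star_chart :: "'v \<Rightarrow> 'v \<Rightarrow> 'v \<Rightarrow> ('v \<Rightarrow> real) \<Rightarrow> real^2" where
  "star_chart a b c x = vector [x a - x c, x b - x c]"

text \<open>Inverse of the chart: if the smallest of the first three coordinates is 0, then
  \<open>x c = - m\<close>. The differences then give \<open>x a\<close> and \<open>x b\<close>, and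
  the total 1 gives \<open>x d\<close>.\<close>

definition star_param :: "'v \<Rightarrow> 'v \<Rightarrow> 'v \<Rightarrow> 'v \<Rightarrow> real^2 \<Rightarrow> 'v \<Rightarrow> real" where
  "star_param a b c d z = (let m = min 0 (min (z $ 1) (z $ 2)) in (\<lambda>v.
     if v = a then z $ 1 - m else if v = b then z $ 2 - m else if v = c then - m
     else if v = d then 1 - z $ 1 - z $ 2 + 3 * m else 0))"

lemma homeomorphism_star_chart:
  assumes d: "distinct [a, b, c, d]"
  shows "homeomorphism (vertex_star a b c d) star_triangle (star_chart a b c) (star_param a b c d)"
proof (rule homeomorphismI)
  have "continuous_on (vertex_star a b c d) (\<lambda>x. x v)" for v
    by (rule continuous_on_subset[OF continuous_on_product_coordinates]) simp
  then have "continuous_on (vertex_star a b c d) (\<lambda>x. if i = 1 then x a - x c else x b - x c)"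
    for i :: 2
    by (cases "i = 1") (auto intro: continuous_on_diff)
  moreover have "star_chart a b c = (\<lambda>x. \<chi> i. if i = 1 then x a - x c else x b - x c)"
    by (auto simp: star_chart_def fun_eq_iff vec_eq_iff forall_2)
  ultimately show "continuous_on (vertex_star a b c d) (star_chart a b c)"
    by (simp add: continuous_on_vec_lambda)
  show "continuous_on star_triangle (star_param a b c d)"
  proof (rule continuous_on_coordinatewise_then_product)
    fix v
    show "continuous_on star_triangle (\<lambda>z. star_param a b c d z v)"
      unfolding star_param_def Let_def
      by (cases "v = a"; cases "v = b"; cases "v = c"; cases "v = d")
        (auto intro!: continuous_intros)
  qed
  show "star_chart a b c ` vertex_star a b c d \<subseteq> star_triangle"
  proof (rule image_subsetI)
    fix x assume x: "x \<in> vertex_star a b c d"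
    have nonneg: "0 \<le> x a" "0 \<le> x b" "0 \<le> x c" "0 \<le> x d" using x by (auto simp: vertex_star_def)
    have "x a + x b + x c + x d = 1" "x a = 0 \<or> x b = 0 \<or> x c = 0"
      using x by (auto simp: vertex_star_def)
    then show "star_chart a b c x \<in> star_triangle"
      using nonneg unfolding star_triangle_def star_chart_def by auto
  qed
  \<comment> \<open>For the three possible values of the minimum, nonnegativity of the coordinate
    \<open>d\<close> is one of the three inequalities of \<open>star_triangle\<close>.\<close>
  show "star_param a b c d ` star_triangle \<subseteq> vertex_star a b c d"
    using d by (auto simp: star_triangle_def star_param_def vertex_star_def Let_def min_def)
  show "star_param a b c d (star_chart a b c x) = x" if x: "x \<in> vertex_star a b c d" for x
  proof
    fix v
    have nonneg: "0 \<le> x a" "0 \<le> x b" "0 \<le> x c" "0 \<le> x d" using x by (auto simp: vertex_star_def)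
    have s: "x a + x b + x c + x d = 1" "x a = 0 \<or> x b = 0 \<or> x c = 0"
      "v \<notin> {a, b, c, d} \<Longrightarrow> x v = 0"
      using x by (auto simp: vertex_star_def)
    have m: "min 0 (min (x a - x c) (x b - x c)) = - x c" using nonneg s(2) by auto
    show "star_param a b c d (star_chart a b c x) v = x v"
      using s(1,3) by (auto simp: star_param_def star_chart_def m Let_def)
  qed
  show "star_chart a b c (star_param a b c d z) = z" if "z \<in> star_triangle" for z
    using d by (auto simp: star_chart_def star_param_def Let_def vec_eq_iff forall_2)
qed

text \<open>This form yields interior, convexity and closedness from the facts about
  half-spaces.\<close>

lemma star_triangle_halfspaces:
  "star_triangle = {z. vector [1, 1] \<bullet> z \<le> 1} \<inter> {z. vector [- 2, 1] \<bullet> z \<le> 1}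
     \<inter> {z. vector [1, - 2] \<bullet> z \<le> 1}"
  by (auto simp: star_triangle_def inner_vec_def sum_2)

lemma interior_star_triangle:
  "interior star_triangle = {z. z $ 1 + z $ 2 < 1 \<and> z $ 2 - 2 * z $ 1 < 1 \<and> z $ 1 - 2 * z $ 2 < 1}"
proof -
  have "vector [1, 1] \<noteq> (0 :: real^2)" "vector [- 2, 1] \<noteq> (0 :: real^2)"
    "vector [1, - 2] \<noteq> (0 :: real^2)"
    by (auto simp: vec_eq_iff forall_2)
  then have "interior star_triangle = {z. vector [1, 1] \<bullet> z < 1} \<inter> {z. vector [- 2, 1] \<bullet> z < 1}
     \<inter> {z. vector [1, - 2] \<bullet> z < 1}"
    unfolding star_triangle_halfspaces interior_Int by (simp only: interior_halfspace_le not_False_eq_True)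
  then show ?thesis by (auto simp: inner_vec_def sum_2)
qed

lemma convex_star_triangle: "convex star_triangle"
  unfolding star_triangle_halfspaces by (intro convex_Int convex_halfspace_le)

lemma compact_star_triangle: "compact star_triangle"
proof -
  have "star_triangle \<subseteq> cbox (- 1) 1"
    by (auto simp: star_triangle_def mem_box_cart forall_2)
  then have "bounded star_triangle" by (rule bounded_subset[OF bounded_cbox])
  moreover have "closed star_triangle"
    unfolding star_triangle_halfspaces by (intro closed_Int closed_halfspace_le)
  ultimately show ?thesis by (simp add: compact_eq_bounded_closed)
qed

text \<open>A compact convex planar set with nonempty interior is a disk; the image 0 of the centre
  is an interior point of the triangle.\<close>

lemma vertex_star_homeomorphic_cball:
  assumes "distinct [a, b, c, d]"
  shows "vertex_star a b c d homeomorphic (cball 0 1 :: (real^2) set)"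
proof -
  have "0 \<in> interior star_triangle" by (simp add: interior_star_triangle)
  then have "interior star_triangle \<noteq> {}" by blast
  then have "star_triangle homeomorphic (cball 0 1 :: (real^2) set)"
    by (intro homeomorphic_convex_compact_cball convex_star_triangle compact_star_triangle) auto
  then show ?thesis
    using homeomorphism_star_chart[OF assms] homeomorphic_def homeomorphic_trans by blast
qed

text \<open>At the chart image of \<open>x\<close> the slacks of the three inequalities are
  \<open>x d + 3 * x c\<close>, \<open>x d + 3 * x a\<close> and \<open>x d + 3 * x b\<close>. As
  one of \<open>x a\<close>, \<open>x b\<close>, \<open>x c\<close> is 0, all slacks are positive
  exactly if \<open>x d\<close> is.\<close>

lemma plane_point_vertex_star:
  assumes "distinct [a, b, c, d]" "x \<in> vertex_star a b c d"
  shows "plane_point (top_of_set (vertex_star a b c d)) x \<longleftrightarrow> 0 < x d"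
proof -
  have "plane_point (top_of_set (vertex_star a b c d)) x \<longleftrightarrow>
      star_chart a b c x \<in> interior star_triangle"
    by (rule plane_point_iff_interior[OF homeomorphism_star_chart[OF assms(1)] assms(2)])
  moreover have nonneg: "0 \<le> x a" "0 \<le> x b" "0 \<le> x c" "0 \<le> x d"
    and "x a + x b + x c + x d = 1" "x a = 0 \<or> x b = 0 \<or> x c = 0"
    using assms(2) by (auto simp: vertex_star_def)
  ultimately show ?thesis by (auto simp: interior_star_triangle star_chart_def)
qed

text \<open>A chart can be shrunk to \<open>U\<close>, which is open in both spaces. This carries
  charts of a star over to the sphere.\<close>

lemma plane_point_open_subset:
  assumes "plane_point (top_of_set S) x" "openin (top_of_set S) U" "openin (top_of_set T) U" "x \<in> U"
  shows "plane_point (top_of_set T) x"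
proof -
  obtain V and W :: "(real^2) set" where V: "openin (top_of_set S) V" "x \<in> V" "open W"
    and VW: "V homeomorphic W"
    using iffD1[OF plane_point_top_of_set assms(1)] by (elim exE conjE) (rule that)
  obtain f g where fg: "homeomorphism V W f g" using VW by (auto simp: homeomorphic_def)
  have VU: "openin (top_of_set S) (V \<inter> U)" using V(1) assms(2) by (rule openin_Int)
  have "openin (top_of_set V) (V \<inter> U)"
    by (rule openin_subset_trans[OF VU _ openin_imp_subset[OF V(1)]]) auto
  then have "openin (top_of_set W) (f ` (V \<inter> U))"
    by (rule homeomorphism_imp_open_map[OF fg])
  then have "open (f ` (V \<inter> U))" using V(3) by (simp add: openin_open_eq)
  moreover have "homeomorphism (V \<inter> U) (f ` (V \<inter> U)) f g"
    by (rule homeomorphism_of_subsets[OF fg Int_lower1]) auto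
  then have "V \<inter> U homeomorphic f ` (V \<inter> U)"
    unfolding homeomorphic_def by blast
  moreover have "openin (top_of_set T) (V \<inter> U)"
  proof -
    have "openin (top_of_set U) (V \<inter> U)"
      by (rule openin_subset_trans[OF VU _ openin_imp_subset[OF assms(2)]]) auto
    then show ?thesis using assms(3) by (rule openin_trans)
  qed
  ultimately show ?thesis
    using V(2) assms(4) by (intro iffD2[OF plane_point_top_of_set] exI conjI) auto
qed

section \<open>The boundary of a tetrahedron as a closed surface\<close>

definition tetrahedron_boundary :: "'v set \<Rightarrow> ('v \<Rightarrow> real) set" where
  "tetrahedron_boundary V = {x. (\<forall>v. 0 \<le> x v) \<and> (\<forall>v. v \<notin> V \<longrightarrow> x v = 0) \<and>
     (\<Sum>v\<in>V. x v) = 1 \<and> (\<exists>v\<in>V. x v = 0)}"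

lemma mem_tetrahedron_boundary:
  assumes "distinct [a, b, c, d]"
  shows "x \<in> tetrahedron_boundary {a, b, c, d} \<longleftrightarrow> (\<forall>v. 0 \<le> x v) \<and>
    (\<forall>v. v \<notin> {a, b, c, d} \<longrightarrow> x v = 0) \<and> x a + x b + x c + x d = 1 \<and>
    (x a = 0 \<or> x b = 0 \<or> x c = 0 \<or> x d = 0)"
proof -
  have "(\<Sum>v\<in>{a, b, c, d}. x v) = x a + x b + x c + x d" using assms by (simp add: add_ac)
  then show ?thesis unfolding tetrahedron_boundary_def mem_Collect_eq by simp
qed

text \<open>A zero among \<open>x a\<close>, \<open>x b\<close>, \<open>x c\<close> puts the point
  into the star of \<open>d\<close>, and \<open>x d = 0\<close> puts it into the star of
  \<open>a\<close>. Compactness and connectedness of the sphere thus come from two disks.\<close>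

lemma tetrahedron_boundary_eq_stars:
  assumes "distinct [a, b, c, d]"
  shows "tetrahedron_boundary {a, b, c, d} = vertex_star a b c d \<union> vertex_star b c d a"
proof -
  have "{b, c, d, a} = {a, b, c, d}" by auto
  moreover have "x b + x c + x d + x a = x a + x b + x c + x d" for x :: "'a \<Rightarrow> real" by simp
  ultimately show ?thesis
    unfolding vertex_star_def set_eq_iff mem_tetrahedron_boundary[OF assms] Un_iff mem_Collect_eq
    by (simp only:) blast
qed

lemma openin_positive_coordinate:
  fixes S :: "('v \<Rightarrow> real) set"
  shows "openin (top_of_set S) {x \<in> S. 0 < x k}"
proof -
  have "open {x :: 'v \<Rightarrow> real. 0 < x k}"
    by (intro open_Collect_less continuous_on_const continuous_on_product_coordinates)
  then have "openin (top_of_set S) (S \<inter> {x. 0 < x k})" by (rule openin_open_Int)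
  moreover have "S \<inter> {x. 0 < x k} = {x \<in> S. 0 < x k}" by auto
  ultimately show ?thesis by simp
qed

text \<open>If \<open>0 < x d\<close>, the vanishing coordinate is one of the other three. So the
  open star of \<open>d\<close> is the same set in the disk and in the sphere, open in both.\<close>

lemma plane_point_tetrahedron_boundary:
  assumes "distinct [a, b, c, d]" "x \<in> tetrahedron_boundary {a, b, c, d}" "0 < x d"
  shows "plane_point (top_of_set (tetrahedron_boundary {a, b, c, d})) x"
proof -
  have eq: "{x \<in> vertex_star a b c d. 0 < x d} = {x \<in> tetrahedron_boundary {a, b, c, d}. 0 < x d}"
    unfolding vertex_star_def mem_tetrahedron_boundary[OF assms(1)] by auto
  then have "x \<in> vertex_star a b c d" using assms(2,3) by blast
  then have "plane_point (top_of_set (vertex_star a b c d)) x"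
    using plane_point_vertex_star[OF assms(1)] assms(3) by blast
  then show ?thesis
    by (rule plane_point_open_subset[OF _ openin_positive_coordinate[of _ d]])
      (use assms openin_positive_coordinate in \<open>auto simp: eq\<close>)
qed

text \<open>The coordinates add up to 1, so every point has a positive one and lies in one of four
  open stars. The sort \<open>countable\<close> makes the function space second countable.\<close>

lemma closed_surface_tetrahedron_boundary:
  fixes a b c d :: "'v::countable"
  assumes d: "distinct [a, b, c, d]"
  shows "closed_surface (top_of_set (tetrahedron_boundary {a, b, c, d}))"
    and "connected_space (top_of_set (tetrahedron_boundary {a, b, c, d}))"
proof -
  let ?X = "top_of_set (tetrahedron_boundary {a, b, c, d})"
  let ?S = "tetrahedron_boundary {a, b, c, d}"
  have d': "distinct [b, c, d, a]" using d by auto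
  note hom = vertex_star_homeomorphic_cball[OF d] vertex_star_homeomorphic_cball[OF d']
  have plane: "plane_point ?X x" if x: "x \<in> ?S" for x
  proof -
    have "0 \<le> x a" "0 \<le> x b" "0 \<le> x c" "0 \<le> x d" "x a + x b + x c + x d = 1"
      using x unfolding mem_tetrahedron_boundary[OF d] by auto
    then consider "0 < x a" | "0 < x b" | "0 < x c" | "0 < x d" by argo
    then show ?thesis
    proof cases
      case 1
      have "{b, c, d, a} = {a, b, c, d}" "distinct [b, c, d, a]" using d by auto
      then show ?thesis using plane_point_tetrahedron_boundary[of b c d a x] x 1 by (simp only:)
    next
      case 2
      have "{a, c, d, b} = {a, b, c, d}" "distinct [a, c, d, b]" using d by auto
      then show ?thesis using plane_point_tetrahedron_boundary[of a c d b x] x 2 by (simp only:)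
    next
      case 3
      have "{a, b, d, c} = {a, b, c, d}" "distinct [a, b, d, c]" using d by auto
      then show ?thesis using plane_point_tetrahedron_boundary[of a b d c x] x 3 by (simp only:)
    next
      case 4
      then show ?thesis using plane_point_tetrahedron_boundary[OF d x] by (simp only:)
    qed
  qed
  have "compact (vertex_star a b c d)" "compact (vertex_star b c d a)"
    using hom homeomorphic_compactness compact_cball by blast+
  then have "compact ?S" unfolding tetrahedron_boundary_eq_stars[OF d] by (rule compact_Un)
  then have "compact_space ?X" by (simp add: compact_space_subtopology)
  moreover have "Hausdorff_space ?X" by (simp add: Hausdorff_space_subtopology)
  moreover have "second_countable ?X"
    by (intro second_countable_subtopology second_countable_euclidean)
  ultimately show "closed_surface ?X"
    using plane plane_point_imp_half_plane_point[OF plane]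
    by (simp add: closed_surface_def surface_def surface_boundary_def)
  have "connected (vertex_star a b c d)" "connected (vertex_star b c d a)"
    using hom homeomorphic_connectedness connected_cball by blast+
  moreover have "vertex_point d \<in> vertex_star a b c d \<inter> vertex_star b c d a"
    using d by (auto simp: vertex_star_def vertex_point_def)
  ultimately have "connected ?S"
    unfolding tetrahedron_boundary_eq_stars[OF d] by (intro connected_Un) auto
  then show "connected_space ?X" by (simp add: connected_space_subtopology)
qed

section \<open>Edge lengths and angles\<close>

text \<open>The odd coefficients vanish, so the remainder has order six. At 0.832, the largest angle
  bound below, the error is less than 0.0005.\<close>

lemma cos_taylor4_error:
  fixes x :: real
  shows "\<bar>cos x - (1 - x\<^sup>2 / 2 + x ^ 4 / 24)\<bar> \<le> x ^ 6 / 720"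
proof -
  obtain t where t: "cos x = (\<Sum>m<6. cos_coeff m * x ^ m)
      + cos (t + 1 / 2 * real 6 * pi) / fact 6 * x ^ 6"
    using Maclaurin_cos_expansion[of x 6] by auto
  have "(\<Sum>m<6. cos_coeff m * x ^ m) = 1 - x\<^sup>2 / 2 + x ^ 4 / 24"
    by (simp add: lessThan_nat_numeral lessThan_Suc cos_coeff_def fact_numeral)
  then have "\<bar>cos x - (1 - x\<^sup>2 / 2 + x ^ 4 / 24)\<bar> = \<bar>cos (t + 1 / 2 * real 6 * pi)\<bar> * (x ^ 6 / 720)"
    unfolding t by (simp add: abs_mult fact_numeral)
  also have "\<dots> \<le> 1 * (x ^ 6 / 720)"
    by (intro mult_right_mono abs_cos_le_one) simp
  finally show ?thesis by simp
qed

text \<open>As \<open>arccos\<close> is decreasing, a polynomial upper bound for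
  \<open>cos t\<close> that stays below \<open>c\<close> suffices; for rational \<open>t\<close>
  only rational arithmetic is left.\<close>

lemma arccos_le_rational:
  assumes "0 \<le> t" "t \<le> 1" "1 - t\<^sup>2 / 2 + t ^ 4 / 24 + t ^ 6 / 720 \<le> c" "c \<le> 1"
  shows "arccos c \<le> t"
proof -
  have "cos t \<le> c" using cos_taylor4_error[of t] assms(3) by linarith
  moreover have t: "t \<le> pi" using assms(2) pi_gt3 by linarith
  ultimately have "arccos c \<le> arccos (cos t)" using assms by (intro arccos_le_arccos) auto
  then show ?thesis using assms t by (simp add: arccos_cos)
qed

lemma le_arccos_rational:
  assumes "0 \<le> t" "t \<le> 1" "c \<le> 1 - t\<^sup>2 / 2 + t ^ 4 / 24 - t ^ 6 / 720" "-1 \<le> c"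
  shows "t \<le> arccos c"
proof -
  have "c \<le> cos t" using cos_taylor4_error[of t] assms(3) by linarith
  moreover have t: "t \<le> pi" using assms(2) pi_gt3 by linarith
  ultimately have "arccos (cos t) \<le> arccos c" using assms by (intro arccos_le_arccos) auto
  then show ?thesis using assms t by (simp add: arccos_cos)
qed

section \<open>The numerical data of the counterexample\<close>

definition inv_dist :: "nat set \<Rightarrow> real" where
  "inv_dist e = (if e = {2, 4} then 4 else if e = {3, 4} then 3 else 1)"

text \<open>The base function \<open>undefined\<close> leaves the values off the four vertices
  unspecified.\<close>

definition radius_r :: "nat \<Rightarrow> real" where
  "radius_r = undefined(1 := 100, 2 := 100, 3 := 100, 4 := 155)"

definition radius_R :: "nat \<Rightarrow> real" where
  "radius_R = undefined(1 := 110, 2 := 240, 3 := 220, 4 := 150)"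

lemma length_radius_r:
  "edge_length inv_dist radius_r 1 2 = 200" "edge_length inv_dist radius_r 1 3 = 200" "edge_length inv_dist radius_r 2 3 = 200"
  "edge_length inv_dist radius_r 4 1 = 255" "edge_length inv_dist radius_r 4 2 = sqrt 158025"
  "edge_length inv_dist radius_r 4 3 = sqrt 127025"
  by (simp_all add: edge_length_def inv_dist_def radius_r_def doubleton_eq_iff real_sqrt_unique)

lemma length_radius_R:
  "edge_length inv_dist radius_R 1 2 = 350" "edge_length inv_dist radius_R 1 3 = 330" "edge_length inv_dist radius_R 2 3 = 460"
  "edge_length inv_dist radius_R 4 1 = 260" "edge_length inv_dist radius_R 4 2 = sqrt 368100"
  "edge_length inv_dist radius_R 4 3 = sqrt 268900"
  by (simp_all add: edge_length_def inv_dist_def radius_R_def doubleton_eq_iff real_sqrt_unique)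

lemma sqrt_bounds:
  "397.5 < sqrt 158025" "sqrt 158025 < 397.6" "356.4 < sqrt 127025" "sqrt 127025 < 356.5"
  "606.7 < sqrt 368100" "sqrt 368100 < 606.8" "518.5 < sqrt 268900" "sqrt 268900 < 518.6"
  by ((rule real_less_rsqrt real_less_lsqrt; simp add: power2_eq_square)+)

definition triangle_lengths ::
    "('v set \<Rightarrow> real) \<Rightarrow> ('v \<Rightarrow> real) \<Rightarrow> 'v \<Rightarrow> 'v \<Rightarrow> 'v \<Rightarrow> bool" where
  "triangle_lengths I r i j k \<longleftrightarrow> edge_length I r i j < edge_length I r i k + edge_length I r j k
    \<and> edge_length I r i k < edge_length I r i j + edge_length I r j k
    \<and> edge_length I r j k < edge_length I r i j + edge_length I r i k"

text \<open>\<open>circle_packing_metric\<close> quantifies over all namings of a face. Cardinality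
  3 excludes coincidences, and symmetry of the lengths reduces the six orders to three
  inequalities.\<close>

lemma triangle_lengths_permute:
  assumes "triangle_lengths I r a b c" "distinct [a, b, c]" "{i, j, k} = {a, b, c}"
  shows "edge_length I r i j < edge_length I r i k + edge_length I r j k"
proof -
  have "card {i, j, k} = 3" using assms(2) unfolding assms(3) by simp
  then have "i \<noteq> j" "i \<noteq> k" "j \<noteq> k" by (auto simp: card_insert_if split: if_splits)
  moreover have "i = a \<or> i = b \<or> i = c" "j = a \<or> j = b \<or> j = c" "k = a \<or> k = b \<or> k = c"
    using assms(3) by blast+
  ultimately show ?thesis
    using assms(1) edge_length_commute[of I r a b] edge_length_commute[of I r a c]
      edge_length_commute[of I r b c]
    unfolding triangle_lengths_def by (elim disjE) (simp_all)
qed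

lemma triangle_lengths_radius_r:
  "triangle_lengths inv_dist radius_r 4 1 2" "triangle_lengths inv_dist radius_r 4 1 3"
  "triangle_lengths inv_dist radius_r 4 2 3" "triangle_lengths inv_dist radius_r 1 2 3"
  using sqrt_bounds unfolding triangle_lengths_def length_radius_r by simp_all

lemma triangle_lengths_radius_R:
  "triangle_lengths inv_dist radius_R 4 1 2" "triangle_lengths inv_dist radius_R 4 1 3"
  "triangle_lengths inv_dist radius_R 4 2 3" "triangle_lengths inv_dist radius_R 1 2 3"
  using sqrt_bounds unfolding triangle_lengths_def length_radius_R by simp_all

lemma inner_angle_triangle:
  assumes "triangle_lengths I r i j k" "i \<noteq> j" "i \<noteq> k" "j \<noteq> k"
  shows "inner_angle I r {i, j, k} i =
    arccos (((edge_length I r i j)\<^sup>2 + (edge_length I r i k)\<^sup>2 - (edge_length I r j k)\<^sup>2) /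
      (2 * edge_length I r i j * edge_length I r i k))"
  using assms unfolding triangle_lengths_def by (intro inner_angle_cosine_law) auto

lemma angles_radius_r:
  "442 / 1000 \<le> inner_angle inv_dist radius_r {4, 1, 2} 4"
  "577 / 1000 \<le> inner_angle inv_dist radius_r {4, 1, 3} 4"
  "524 / 1000 \<le> inner_angle inv_dist radius_r {4, 2, 3} 4"
proof -
  have ne1: "4 \<noteq> (1 :: nat)" "4 \<noteq> (2 :: nat)" "1 \<noteq> (2 :: nat)"
    and ne2: "4 \<noteq> (1 :: nat)" "4 \<noteq> (3 :: nat)" "1 \<noteq> (3 :: nat)"
    and ne3: "4 \<noteq> (2 :: nat)" "4 \<noteq> (3 :: nat)" "2 \<noteq> (3 :: nat)"
    by simp_all
  \<comment> \<open>In the face {2,3,4} both sides at 4 are irrational. Bounding their product as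
    one term keeps the test linear; \<open>mult.assoc\<close> below exposes that term.\<close>
  have p: "397.5 * 356.4 \<le> sqrt 158025 * sqrt 127025"
    using sqrt_bounds by (intro mult_mono) auto
  show "442 / 1000 \<le> inner_angle inv_dist radius_r {4, 1, 2} 4"
    unfolding inner_angle_triangle[OF triangle_lengths_radius_r(1) ne1] length_radius_r
    by (rule le_arccos_rational) (use sqrt_bounds in \<open>simp_all add: field_simps power_divide\<close>)
  show "577 / 1000 \<le> inner_angle inv_dist radius_r {4, 1, 3} 4"
    unfolding inner_angle_triangle[OF triangle_lengths_radius_r(2) ne2] length_radius_r
    by (rule le_arccos_rational) (use sqrt_bounds in \<open>simp_all add: field_simps power_divide\<close>)
  show "524 / 1000 \<le> inner_angle inv_dist radius_r {4, 2, 3} 4"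
    unfolding inner_angle_triangle[OF triangle_lengths_radius_r(3) ne3] length_radius_r mult.assoc
    by (rule le_arccos_rational) (use p in \<open>simp_all add: field_simps power_divide\<close>)
qed

lemma angles_radius_R:
  "inner_angle inv_dist radius_R {4, 1, 2} 4 \<le> 124 / 1000"
  "inner_angle inv_dist radius_R {4, 1, 3} 4 \<le> 570 / 1000"
  "inner_angle inv_dist radius_R {4, 2, 3} 4 \<le> 832 / 1000"
proof -
  have ne1: "4 \<noteq> (1 :: nat)" "4 \<noteq> (2 :: nat)" "1 \<noteq> (2 :: nat)"
    and ne2: "4 \<noteq> (1 :: nat)" "4 \<noteq> (3 :: nat)" "1 \<noteq> (3 :: nat)"
    and ne3: "4 \<noteq> (2 :: nat)" "4 \<noteq> (3 :: nat)" "2 \<noteq> (3 :: nat)"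
    by simp_all
  have p: "sqrt 368100 * sqrt 268900 \<le> 606.8 * 518.6"
    using sqrt_bounds by (intro mult_mono) auto
  \<comment> \<open>An upper bound on the denominator bounds the cosine from below; this lower bound
    serves the side condition that the cosine is at most 1.\<close>
  have q: "606.7 * 518.5 \<le> sqrt 368100 * sqrt 268900"
    using sqrt_bounds by (intro mult_mono) auto
  show "inner_angle inv_dist radius_R {4, 1, 2} 4 \<le> 124 / 1000"
    unfolding inner_angle_triangle[OF triangle_lengths_radius_R(1) ne1] length_radius_R
    by (rule arccos_le_rational) (use sqrt_bounds in \<open>simp_all add: field_simps power_divide\<close>)
  show "inner_angle inv_dist radius_R {4, 1, 3} 4 \<le> 570 / 1000"
    unfolding inner_angle_triangle[OF triangle_lengths_radius_R(2) ne2] length_radius_R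
    by (rule arccos_le_rational) (use sqrt_bounds in \<open>simp_all add: field_simps power_divide\<close>)
  show "inner_angle inv_dist radius_R {4, 2, 3} 4 \<le> 832 / 1000"
    unfolding inner_angle_triangle[OF triangle_lengths_radius_R(3) ne3] length_radius_R mult.assoc
    by (rule arccos_le_rational) (use p q in \<open>simp_all add: field_simps power_divide\<close>)
qed

text \<open>Only the faces at 4 are prescribed, so the formula applies to the disk and to the
  sphere. Vertex 4 is written first to fit the cosine law.\<close>

lemma curvature_vertex4:
  assumes "{t \<in> faces T. 4 \<in> t} = {{1, 2, 4}, {1, 3, 4}, {2, 3, 4 :: nat}}"
  shows "curvature T I r 4 = 2 * pi - (inner_angle I r {4, 1, 2} 4 + inner_angle I r {4, 1, 3} 4
    + inner_angle I r {4, 2, 3} 4)"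
proof -
  have e: "{4, 1, 2} = {1, 2, 4 :: nat}" "{4, 1, 3} = {1, 3, 4 :: nat}" "{4, 2, 3} = {2, 3, 4 :: nat}"
    by auto
  \<comment> \<open>The faces must differ as sets, or the sum would have fewer than three terms;
    each misses a vertex that the other two contain.\<close>
  have "3 \<notin> {1, 2, 4 :: nat}" "2 \<notin> {1, 3, 4 :: nat}" "1 \<notin> {2, 3, 4 :: nat}" by simp_all
  then have "{1, 2, 4} \<noteq> {1, 3, 4 :: nat}" "{1, 2, 4} \<noteq> {2, 3, 4 :: nat}" "{1, 3, 4} \<noteq> {2, 3, 4 :: nat}"
    by blast+
  then show ?thesis unfolding curvature_def assms e by simp
qed

lemma curvature_vertex4_less:
  assumes "{t \<in> faces T. 4 \<in> t} = {{1, 2, 4}, {1, 3, 4}, {2, 3, 4 :: nat}}"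
  shows "curvature T inv_dist radius_r 4 < curvature T inv_dist radius_R 4"
  unfolding curvature_vertex4[OF assms] using angles_radius_r angles_radius_R by linarith

text \<open>Admitting any subset of the four triples covers the disk and the sphere at once.\<close>

lemma circle_packing_metrics:
  assumes "verts T = {1, 2, 3, 4 :: nat}"
    and "faces T \<subseteq> {{1, 2, 4}, {1, 3, 4}, {2, 3, 4}, {1, 2, 3}}"
  shows "circle_packing_metric T inv_dist radius_r" "circle_packing_metric T inv_dist radius_R"
proof -
  have "circle_packing_metric T I r" if pos: "0 < r 1" "0 < r 2" "0 < r 3" "0 < r 4"
    and tri: "triangle_lengths I r 4 1 2" "triangle_lengths I r 4 1 3" "triangle_lengths I r 4 2 3"
      "triangle_lengths I r 1 2 3" for I and r :: "nat \<Rightarrow> real"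
    unfolding circle_packing_metric_def
  proof (intro conjI allI impI)
    show "\<forall>i\<in>verts T. 0 < r i" using pos by (simp add: assms)
    fix i j k assume "{i, j, k} \<in> faces T"
    then have "{i, j, k} \<in> {{1, 2, 4}, {1, 3, 4}, {2, 3, 4}, {1, 2, 3}}"
      using subsetD[OF assms(2)] by simp
    then consider "{i, j, k} = {1, 2, 4}" | "{i, j, k} = {1, 3, 4}" | "{i, j, k} = {2, 3, 4}"
      | "{i, j, k} = {1, 2, 3}" unfolding insert_iff empty_iff by argo
    then show "edge_length I r i j < edge_length I r i k + edge_length I r j k"
    proof cases
      case 1
      then have "{i, j, k} = {4, 1, 2}" by auto
      then show ?thesis by (rule triangle_lengths_permute[OF tri(1), rotated]) simp
    next
      case 2
      then have "{i, j, k} = {4, 1, 3}" by auto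
      then show ?thesis by (rule triangle_lengths_permute[OF tri(2), rotated]) simp
    next
      case 3
      then have "{i, j, k} = {4, 2, 3}" by auto
      then show ?thesis by (rule triangle_lengths_permute[OF tri(3), rotated]) simp
    next
      case 4 show ?thesis by (rule triangle_lengths_permute[OF tri(4) _ 4]) simp
    qed
  qed
  note this[OF _ _ _ _ triangle_lengths_radius_r] this[OF _ _ _ _ triangle_lengths_radius_R]
  then show "circle_packing_metric T inv_dist radius_r" "circle_packing_metric T inv_dist radius_R"
    by (simp_all add: radius_r_def radius_R_def)
qed

section \<open>The disk and the sphere\<close>

definition disk_complex :: "nat complex2" where
  "disk_complex = \<lparr>verts = {1, 2, 3, 4}, edges = {e. e \<subseteq> {1, 2, 3, 4} \<and> card e = 2},
     faces = {{1, 2, 4}, {1, 3, 4}, {2, 3, 4}}\<rparr>"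

definition sphere_complex :: "nat complex2" where
  "sphere_complex = \<lparr>verts = {1, 2, 3, 4}, edges = {e. e \<subseteq> {1, 2, 3, 4} \<and> card e = 2},
     faces = {f. f \<subseteq> {1, 2, 3, 4} \<and> card f = 3}\<rparr>"

lemma triples_of_four:
  "{f. f \<subseteq> {1, 2, 3, 4 :: nat} \<and> card f = 3} = {{1, 2, 4}, {1, 3, 4}, {2, 3, 4}, {1, 2, 3}}"
proof
  show "{f. f \<subseteq> {1, 2, 3, 4 :: nat} \<and> card f = 3} \<subseteq> {{1, 2, 4}, {1, 3, 4}, {2, 3, 4}, {1, 2, 3}}"
  proof
    fix f :: "nat set" assume "f \<in> {f. f \<subseteq> {1, 2, 3, 4} \<and> card f = 3}"
    then have f: "f \<subseteq> {1, 2, 3, 4}" "card f = 3" by auto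
    \<comment> \<open>A triple is determined by the one vertex that it misses.\<close>
    have "card ({1, 2, 3, 4} - f) = 1" using f by (subst card_Diff_subset) (auto intro: finite_subset)
    then obtain k where k: "{1, 2, 3, 4} - f = {k}" by (auto simp: card_1_singleton_iff)
    then have "f = {1, 2, 3, 4} - {k}" "k = 1 \<or> k = 2 \<or> k = 3 \<or> k = 4" using f(1) by blast+
    then show "f \<in> {{1, 2, 4}, {1, 3, 4}, {2, 3, 4}, {1, 2, 3}}"
      by (elim disjE) (simp_all add: insert_Diff_if)
  qed
qed simp

text \<open>The sizes 1, 2, 3 of simplices are those of the nonempty proper subsets of a set of four
  elements.\<close>

lemma simplices_sphere_complex: "s \<in> simplices sphere_complex \<longleftrightarrow> s \<noteq> {} \<and> s \<subset> {1, 2, 3, 4}"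
proof
  assume s: "s \<noteq> {} \<and> s \<subset> {1, 2, 3, 4}"
  then have "finite s" by (meson finite.emptyI finite.insertI finite_subset psubset_imp_subset)
  moreover have "card s < card {1, 2, 3, 4 :: nat}" using s by (intro psubset_card_mono) auto
  ultimately have "card s = 1 \<or> card s = 2 \<or> card s = 3" using s card_gt_0_iff[of s] by auto
  then show "s \<in> simplices sphere_complex"
    using s by (auto simp: simplices_def sphere_complex_def card_1_singleton_iff)
next
  assume "s \<in> simplices sphere_complex"
  then have "s \<subseteq> {1, 2, 3, 4} \<and> (card s = 1 \<or> card s = 2 \<or> card s = 3)"
    unfolding simplices_def sphere_complex_def complex2.select_convs by (elim UnE imageE) simp_all
  moreover have "s \<noteq> {}" if "card s = 1 \<or> card s = 2 \<or> card s = 3" using that by force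
  moreover have "s \<noteq> {1, 2, 3, 4}" if "card s = 1 \<or> card s = 2 \<or> card s = 3" using that by force
  ultimately show "s \<noteq> {} \<and> s \<subset> {1, 2, 3, 4}" by blast
qed

text \<open>The disk is the sphere without the face {1,2,3}. The clause
  \<open>\<not> {1, 2, 3} \<subseteq> s\<close>, read for the support of a point, is the last clause
  of \<open>vertex_star\<close>.\<close>

lemma simplices_disk_complex:
  "s \<in> simplices disk_complex \<longleftrightarrow> s \<noteq> {} \<and> s \<subseteq> {1, 2, 3, 4} \<and> \<not> {1, 2, 3} \<subseteq> s"
proof -
  have "simplices sphere_complex = insert {1, 2, 3} (simplices disk_complex)"
    unfolding simplices_def sphere_complex_def disk_complex_def triples_of_four by auto
  moreover have "{1, 2, 3} \<notin> simplices disk_complex"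
  proof -
    have "4 \<notin> {1, 2, 3 :: nat}" by simp
    then have "{1, 2, 3 :: nat} \<notin> {{1, 2, 4}, {1, 3, 4}, {2, 3, 4}}" by blast
    then show ?thesis by (auto simp: simplices_def disk_complex_def)
  qed
  ultimately have "s \<in> simplices disk_complex \<longleftrightarrow> s \<noteq> {} \<and> s \<subset> {1, 2, 3, 4} \<and> s \<noteq> {1, 2, 3}"
    using simplices_sphere_complex[of s] by blast
  also have "\<dots> \<longleftrightarrow> s \<noteq> {} \<and> s \<subseteq> {1, 2, 3, 4} \<and> \<not> {1, 2, 3} \<subseteq> s" by blast
  finally show ?thesis .
qed

lemma realization_sphere_complex:
  "realization sphere_complex = top_of_set (tetrahedron_boundary {1, 2, 3, 4})"
proof -
  have "{v. x v \<noteq> 0} \<noteq> {} \<and> {v. x v \<noteq> 0} \<subset> {1, 2, 3, 4} \<longleftrightarrow>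
      (\<forall>v. v \<notin> {1, 2, 3, 4} \<longrightarrow> x v = 0) \<and> (\<exists>v\<in>{1, 2, 3, 4}. x v = 0)"
    if "(\<Sum>v\<in>{1, 2, 3, 4}. x v) = 1" for x :: "nat \<Rightarrow> real"
  proof -
    \<comment> \<open>The support cannot be empty since the coordinates add up to 1.\<close>
    have "{v. x v \<noteq> 0} \<noteq> {}"
    proof
      assume "{v. x v \<noteq> 0} = {}"
      then have "x v = 0" for v by blast
      then show False using that by simp
    qed
    then show ?thesis by blast
  qed
  then show ?thesis
    unfolding realization_def tetrahedron_boundary_def simplices_sphere_complex
    by (intro arg_cong[of _ _ top_of_set] Collect_cong) (auto simp: sphere_complex_def)
qed

lemma realization_disk_complex: "realization disk_complex = top_of_set (vertex_star 1 2 3 4)"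
proof -
  have "{v. x v \<noteq> 0} \<noteq> {} \<and> {v. x v \<noteq> 0} \<subseteq> {1, 2, 3, 4} \<and> \<not> {1, 2, 3} \<subseteq> {v. x v \<noteq> 0} \<longleftrightarrow>
      (\<forall>v. v \<notin> {1, 2, 3, 4} \<longrightarrow> x v = 0) \<and> (x 1 = 0 \<or> x 2 = 0 \<or> x 3 = 0)"
    if "x 1 + x 2 + x 3 + x 4 = 1" for x :: "nat \<Rightarrow> real"
  proof -
    have "{v. x v \<noteq> 0} \<noteq> {}"
    proof
      assume "{v. x v \<noteq> 0} = {}"
      then have "x v = 0" for v by blast
      then show False using that by simp
    qed
    then show ?thesis by blast
  qed
  then show ?thesis
    unfolding realization_def vertex_star_def simplices_disk_complex
    by (intro arg_cong[of _ _ top_of_set] Collect_cong) (auto simp: disk_complex_def)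
qed

lemma simplicial_complex2_sphere: "simplicial_complex2 sphere_complex"
  unfolding simplicial_complex2_def sphere_complex_def complex2.select_convs mem_Collect_eq
proof (intro conjI ballI allI impI)
  fix f e :: "nat set"
  assume "f \<in> {f. f \<subseteq> {1, 2, 3, 4} \<and> card f = 3}" "e \<subseteq> f \<and> card e = 2"
  then show "e \<subseteq> {1, 2, 3, 4}" "card e = 2" using subset_trans[of e f] by simp_all
next
  show "finite {1, 2, 3, 4 :: nat}" by simp
  fix e :: "nat set" assume "e \<in> {e. e \<subseteq> {1, 2, 3, 4} \<and> card e = 2}"
  then show "e \<subseteq> {1, 2, 3, 4}" "card e = 2" by blast+
next
  fix f :: "nat set" assume "f \<in> {f. f \<subseteq> {1, 2, 3, 4} \<and> card f = 3}"
  then show "f \<subseteq> {1, 2, 3, 4}" "card f = 3" by blast+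
qed

lemma simplicial_complex2_disk: "simplicial_complex2 disk_complex"
proof -
  have "verts disk_complex = verts sphere_complex" "edges disk_complex = edges sphere_complex"
    by (simp_all add: disk_complex_def sphere_complex_def)
  moreover have "faces disk_complex \<subseteq> faces sphere_complex"
    by (simp add: disk_complex_def sphere_complex_def)
  ultimately show ?thesis
    using simplicial_complex2_sphere unfolding simplicial_complex2_def by (metis subsetD)
qed

lemma triangulated_surface_disk:
  "triangulated_surface (top_of_set (cball 0 1 :: (real^2) set)) disk_complex"
  unfolding triangulated_surface_def realization_disk_complex top_of_set_homeomorphic_space
proof (intro conjI surface_cball simplicial_complex2_disk)
  have "vertex_star 1 2 3 (4 :: nat) homeomorphic (cball 0 1 :: (real^2) set)"
    by (rule vertex_star_homeomorphic_cball) simp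
  then show "(cball 0 1 :: (real^2) set) homeomorphic vertex_star 1 2 3 (4 :: nat)"
    by (rule iffD1[OF homeomorphic_sym])
qed

text \<open>By \<open>plane_point_vertex_star\<close> only the coordinate at 4 matters, and among
  the four vertex points it is positive only at vertex 4 itself.\<close>

lemma boundary_vertices_disk: "boundary_vertices disk_complex = {1, 2, 3}"
proof -
  have "vertex_point v \<in> vertex_star 1 2 3 4" if "v \<in> {1, 2, 3, 4}" for v :: nat
    using that by (auto simp: vertex_star_def vertex_point_def)
  then have "boundary_vertices disk_complex = {v \<in> {1, 2, 3, 4}. \<not> 0 < vertex_point v (4 :: nat)}"
    using plane_point_vertex_star[of 1 2 3 "4 :: nat"]
    unfolding boundary_vertices_def surface_boundary_def realization_disk_complex
    by (auto simp: disk_complex_def)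
  also have "\<dots> = {1, 2, 3}" by (auto simp: vertex_point_def)
  finally show ?thesis .
qed

lemma star_of_vertex4:
  "{t \<in> faces disk_complex. 4 \<in> t} = {{1, 2, 4}, {1, 3, 4}, {2, 3, 4}}"
  "{t \<in> faces sphere_complex. 4 \<in> t} = {{1, 2, 4}, {1, 3, 4}, {2, 3, 4}}"
proof -
  have "4 \<notin> {1, 2, 3 :: nat}" by simp
  then show "{t \<in> faces disk_complex. 4 \<in> t} = {{1, 2, 4}, {1, 3, 4}, {2, 3, 4}}"
    "{t \<in> faces sphere_complex. 4 \<in> t} = {{1, 2, 4}, {1, 3, 4}, {2, 3, 4}}"
    unfolding sphere_complex_def disk_complex_def triples_of_four complex2.select_convs by blast+
qed

lemma inv_dist_ge_1: "1 \<le> inv_dist e" by (simp add: inv_dist_def)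

lemma circle_packing_metrics_disk:
  "circle_packing_metric disk_complex inv_dist radius_r" "circle_packing_metric disk_complex inv_dist radius_R"
proof -
  have "verts disk_complex = {1, 2, 3, 4}"
    "faces disk_complex \<subseteq> {{1, 2, 4}, {1, 3, 4}, {2, 3, 4}, {1, 2, 3}}"
    unfolding disk_complex_def complex2.select_convs by blast+
  then show "circle_packing_metric disk_complex inv_dist radius_r" "circle_packing_metric disk_complex inv_dist radius_R"
    by (rule circle_packing_metrics)+
qed

lemma circle_packing_metrics_sphere:
  "circle_packing_metric sphere_complex inv_dist radius_r" "circle_packing_metric sphere_complex inv_dist radius_R"
proof -
  have "verts sphere_complex = {1, 2, 3, 4}"
    "faces sphere_complex \<subseteq> {{1, 2, 4}, {1, 3, 4}, {2, 3, 4}, {1, 2, 3}}"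
    unfolding sphere_complex_def complex2.select_convs triples_of_four by blast+
  then show "circle_packing_metric sphere_complex inv_dist radius_r"
    "circle_packing_metric sphere_complex inv_dist radius_R"
    by (rule circle_packing_metrics)+
qed

theorem mainTheorem2:
  shows
  "(let D = top_of_set (cball 0 1 :: (real^2) set);
        T = \<lparr>verts = {1, 2, 3, 4 :: nat},
             edges = {e. e \<subseteq> {1, 2, 3, 4} \<and> card e = 2},
             faces = {{1, 2, 4}, {1, 3, 4}, {2, 3, 4}}\<rparr>;
        A = {4};
        B = {1, 2, 3};
        I = (\<lambda>e. if e = {2, 4} then 4 else if e = {3, 4} then 3 else 1);
        r = undefined(1 := 100, 2 := 100, 3 := 100, 4 := 155);
        R = undefined(1 := 110, 2 := 240, 3 := 220, 4 := 150)
    in weighted_triangulated_surface D T I \<and>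
       interior_vertices T = A \<and> boundary_vertices T = B \<and>
       circle_packing_metric T I r \<and> circle_packing_metric T I R \<and>
       (\<forall>i\<in>B. R i \<ge> r i) \<and> curvature T I R 4 \<ge> curvature T I r 4 \<and> R 4 < r 4)
   \<and>
   (\<exists>(S' :: (nat \<Rightarrow> real) topology) (T' :: nat complex2) (I' :: nat set \<Rightarrow> real)
      (A' :: nat set) (B' :: nat set) (R' :: nat \<Rightarrow> real) (r' :: nat \<Rightarrow> real).
       closed_surface S' \<and> connected_space S' \<and> weighted_triangulated_surface S' T' I' \<and>
       (\<forall>e\<in>edges T'. I' e \<ge> 1) \<and>
       verts T' = A' \<union> B' \<and> A' \<inter> B' = {} \<and> A' \<noteq> {} \<and> B' \<noteq> {} \<and>
       circle_packing_metric T' I' R' \<and> circle_packing_metric T' I' r' \<and>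
       (\<forall>i\<in>B'. R' i \<ge> r' i) \<and> (\<forall>i\<in>A'. curvature T' I' R' i \<ge> curvature T' I' r' i) \<and>
       (\<exists>i\<in>A'. R' i < r' i))"
proof (rule conjI)
  have I: "inv_dist = (\<lambda>e. if e = {2, 4} then 4 else if e = {3, 4} then 3 else 1)"
    by (rule ext) (simp only: inv_dist_def)
  have I0: "- 1 < inv_dist e" for e using inv_dist_ge_1[of e] by linarith
  have rR: "\<forall>i\<in>{1, 2, 3}. radius_r i \<le> radius_R i" "radius_R 4 < radius_r 4" by (auto simp: radius_r_def radius_R_def)
  have "interior_vertices disk_complex = {4}"
    unfolding interior_vertices_def boundary_vertices_disk by (auto simp: disk_complex_def)
  then show "let D = top_of_set (cball 0 1 :: (real^2) set);
        T = \<lparr>verts = {1, 2, 3, 4 :: nat},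
             edges = {e. e \<subseteq> {1, 2, 3, 4} \<and> card e = 2},
             faces = {{1, 2, 4}, {1, 3, 4}, {2, 3, 4}}\<rparr>;
        A = {4};
        B = {1, 2, 3};
        I = (\<lambda>e. if e = {2, 4} then 4 else if e = {3, 4} then 3 else 1);
        r = undefined(1 := 100, 2 := 100, 3 := 100, 4 := 155);
        R = undefined(1 := 110, 2 := 240, 3 := 220, 4 := 150)
    in weighted_triangulated_surface D T I \<and>
       interior_vertices T = A \<and> boundary_vertices T = B \<and>
       circle_packing_metric T I r \<and> circle_packing_metric T I R \<and>
       (\<forall>i\<in>B. R i \<ge> r i) \<and> curvature T I R 4 \<ge> curvature T I r 4 \<and> R 4 < r 4"
    unfolding Let_def disk_complex_def[symmetric] I[symmetric] radius_r_def[symmetric] radius_R_def[symmetric]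
      weighted_triangulated_surface_def
    by (intro conjI triangulated_surface_disk ballI I0 boundary_vertices_disk
        circle_packing_metrics_disk less_imp_le[OF curvature_vertex4_less] star_of_vertex4 rR[rule_format])
  \<comment> \<open>The realization itself serves as the surface, so the homeomorphism demanded by
    \<open>triangulated_surface\<close> is trivial.\<close>
  let ?S = "top_of_set (tetrahedron_boundary {1, 2, 3, 4 :: nat})"
  have S: "closed_surface ?S" "connected_space ?S"
    by (rule closed_surface_tetrahedron_boundary; simp)+
  then have "weighted_triangulated_surface ?S sphere_complex inv_dist"
    using I0 simplicial_complex2_sphere
    by (simp add: weighted_triangulated_surface_def triangulated_surface_def closed_surface_def
        realization_sphere_complex)
  moreover have "verts sphere_complex = {4} \<union> {1, 2, 3}" by (auto simp: sphere_complex_def)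
  ultimately show "\<exists>(S' :: (nat \<Rightarrow> real) topology) (T' :: nat complex2) (I' :: nat set \<Rightarrow> real)
      (A' :: nat set) (B' :: nat set) (R' :: nat \<Rightarrow> real) (r' :: nat \<Rightarrow> real).
       closed_surface S' \<and> connected_space S' \<and> weighted_triangulated_surface S' T' I' \<and>
       (\<forall>e\<in>edges T'. I' e \<ge> 1) \<and>
       verts T' = A' \<union> B' \<and> A' \<inter> B' = {} \<and> A' \<noteq> {} \<and> B' \<noteq> {} \<and>
       circle_packing_metric T' I' R' \<and> circle_packing_metric T' I' r' \<and>
       (\<forall>i\<in>B'. R' i \<ge> r' i) \<and> (\<forall>i\<in>A'. curvature T' I' R' i \<ge> curvature T' I' r' i) \<and>
       (\<exists>i\<in>A'. R' i < r' i)"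
    \<comment> \<open>The partition is that of the disk: curvatures are compared at 4 only, while 1,
      2, 3 now form an arbitrary set \<open>B'\<close> of vertices of a closed surface.\<close>
    using S inv_dist_ge_1 circle_packing_metrics_sphere rR curvature_vertex4_less[OF star_of_vertex4(2)]
    by (intro exI[of _ ?S] exI[of _ sphere_complex] exI[of _ inv_dist] exI[of _ "{4}"]
        exI[of _ "{1, 2, 3}"] exI[of _ radius_R] exI[of _ radius_r]) simp
qed

end
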